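(* There is a universal constant $A>0$ such that the following holds. Let $\theta$ be a solution of $$\partial_t\theta+u\,\partial_x\theta=0,\qquad u=H\theta,$$ which is $C^1$ and such that $\theta(t,\cdot)$ is even and monotone decreasing for $x\in(0,\infty)$. Let $h=\theta(0,1/2)$ be the value of $\theta$ at time $t=0$ and position $x=1/2$. Then $$\theta(t,x)\le h+\frac At\,(1-|x|^{1/2})^+$$ for all $x\in\mathbb{R}$ and all $t>0$ (in the time interval on which the solution is defined).
   Context: $H$ is the Hilbert transform in $x$, $H\theta(x)=\frac1\pi\,\mathrm{p.v.}\int_{\mathbb{R}}\frac{\theta(y)}{y-x}\,dy$; for even $\theta$, $H\theta(x)=\frac{2x}{\pi}\int_0^\infty\frac{\theta(y)-\theta(x)}{y^2-x^2}\,dy$. Notation: $z^+=\max(z,0)$. The solution satisfies the equation pointwise, starting from time $t=0$, with $H\theta$ well defined. *)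

theory Defs
  imports "HOL-Analysis.Analysis"
begin

text \<open>
  \<open>has_hilbert_transform f v x\<close> says that \<open>H f(x) = 1/\<pi> p.v. \<integral> f(y)/(y - x) dy\<close> is well defined
  and equals \<open>v\<close>.  Note the sign convention \<open>y - x\<close>.  The principal value is taken both at \<open>y = x\<close>
  and at infinity: when \<open>f(y)/(y - x)\<close> is absolutely integrable away from \<open>x\<close> this is the usual
  \<open>\<epsilon> \<rightarrow> 0\<close> principal value, and it also covers even functions without decay, for which the
  two tails cancel as in \<open>2x/\<pi> \<integral>\<^sub>0 (f(y) - f(x))/(y\<^sup>2 - x\<^sup>2) dy\<close>.
\<close>

definition has_hilbert_transform :: "(real \<Rightarrow> real) \<Rightarrow> real \<Rightarrow> real \<Rightarrow> bool" where
  "has_hilbert_transform f v x \<longleftrightarrow>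
     (\<forall>\<epsilon> R. 0 < \<epsilon> \<and> \<epsilon> < R \<longrightarrow>
        set_integrable lborel {y. \<epsilon> < \<bar>y - x\<bar> \<and> \<bar>y - x\<bar> < R} (\<lambda>y. f y / (y - x))) \<and>
     ((\<lambda>(\<epsilon>, R). 1 / pi * (LINT y:{y. \<epsilon> < \<bar>y - x\<bar> \<and> \<bar>y - x\<bar> < R}|lborel. f y / (y - x))) \<longlongrightarrow> v)
       (at_right 0 \<times>\<^sub>F at_top)"

text \<open>
  \<open>\<theta>\<close> is \<open>C\<^sup>1\<close> on \<open>I \<times> \<real>\<close> with partial derivatives \<open>\<theta>t\<close> and \<open>\<theta>x\<close>.  The time derivative is
  one-sided at an end point belonging to the interval \<open>I\<close>, in particular at the initial time.
\<close>

definition C1_partials ::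
    "real set \<Rightarrow> (real \<Rightarrow> real \<Rightarrow> real) \<Rightarrow> (real \<Rightarrow> real \<Rightarrow> real) \<Rightarrow> (real \<Rightarrow> real \<Rightarrow> real) \<Rightarrow> bool" where
  "C1_partials I \<theta> \<theta>t \<theta>x \<longleftrightarrow>
     (\<forall>t\<in>I. \<forall>x. ((\<lambda>s. \<theta> s x) has_real_derivative \<theta>t t x) (at t within I)) \<and>
     (\<forall>t\<in>I. \<forall>x. (\<theta> t has_real_derivative \<theta>x t x) (at x)) \<and>
     continuous_on (I \<times> UNIV) (\<lambda>(t, x). \<theta>t t x) \<and>
     continuous_on (I \<times> UNIV) (\<lambda>(t, x). \<theta>x t x)"

definition C1_transport_solution :: "real set \<Rightarrow> (real \<Rightarrow> real \<Rightarrow> real) \<Rightarrow> bool" where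
  "C1_transport_solution I \<theta> \<longleftrightarrow>
     (\<exists>\<theta>t \<theta>x u. C1_partials I \<theta> \<theta>t \<theta>x \<and>
        (\<forall>t\<in>I. \<forall>x. has_hilbert_transform (\<theta> t) (u t x) x \<and>
                   \<theta>t t x + u t x * \<theta>x t x = 0))"

end

theory Submission
  imports Defs
begin

text \<open>
  For a function that is even and decreasing on the positive half-line, the principal value at
  \<open>x > 0\<close> is the integral of \<open>(f(x + s) - f(x - s))/s\<close> over \<open>s > 0\<close>, whose integrand is nonpositive.
  So \<open>u \<le> 0\<close> on the positive half-line, \<open>\<theta>(\<cdot>, x)\<close> decreases in time, and \<open>\<theta> \<le> h\<close> for \<open>\<bar>x\<bar> \<ge> 1/2\<close>.
  If the graph of \<open>\<theta>\<close> touches the barrier \<open>h + A/t (1 - \<bar>x\<bar>\<^bsup>1/2\<^esup>)\<close> for the first time at \<open>(t, x)\<close>,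
  then \<open>0 < x < 1/2\<close> (the barrier has a cusp at the origin), and comparing with the barrier on
  \<open>[x, 2x]\<close> gives \<open>u \<le> - c A x\<^bsup>1/2\<^esup>/t\<close>. Since \<open>\<theta>\<^sub>x = - A x\<^bsup>-1/2\<^esup>/(2t)\<close> at the contact point, \<open>\<theta>\<^sub>t\<close> is at
  most a negative multiple of \<open>A\<^sup>2/t\<^sup>2\<close>, whereas the barrier moves down at speed at most \<open>A/t\<^sup>2\<close>;
  this is impossible when \<open>A\<close> is large.
\<close>

lemma antimono_on_atLeast_zero:
  fixes f :: "real \<Rightarrow> real"
  assumes anti: "antimono_on {0<..} f" and cont: "isCont f 0"
  shows "antimono_on {0..} f"
proof (rule monotone_onI)
  fix x y :: real
  assume xy: "x \<in> {0..}" "y \<in> {0..}" "x \<le> y"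
  show "f x \<ge> f y"
  proof (cases "x = 0 \<and> y > 0")
    case True
    have "(f \<longlongrightarrow> f 0) (at_right 0)"
      using cont by (simp add: isCont_def filterlim_at_split)
    moreover have "eventually (\<lambda>z. f y \<le> f z) (at_right 0)"
      using eventually_at_right_real[of 0 y] True
      by (auto elim!: eventually_mono intro!: monotone_onD[OF anti])
    ultimately show ?thesis
      using True by (auto intro: tendsto_lowerbound)
  next
    case False
    then consider "x = y" | "x > 0" using xy by fastforce
    then show ?thesis
      using monotone_onD[OF anti, of x y] xy by cases auto
  qed
qed

text \<open>Folding about \<open>x\<close> turns the truncated integral into one of
  \<open>(f (x + s) - f (x - s)) / s\<close>, which is nonpositive, and at most \<open>- c\<close>
  for \<open>s < x\<close>. Keeping only \<open>x/2 \<le> s < x\<close> gives a bound uniform in the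
  truncation. The case \<open>c = 0\<close> gives the sign of \<open>v\<close>.\<close>

lemma hilbert_transform_le:
  fixes f :: "real \<Rightarrow> real"
  assumes H: "has_hilbert_transform f v x"
    and even: "\<And>y. f (- y) = f y"
    and anti: "antimono_on {0..} f"
    and x: "x > 0" and c: "c \<ge> 0"
    and slope: "\<And>s. 0 < s \<Longrightarrow> s < x \<Longrightarrow> f (x + s) \<le> f x - c * s"
  shows "v \<le> - (c * x / (2 * pi))"
proof -
  define S where "S e R = {y. e < \<bar>y - x\<bar> \<and> \<bar>y - x\<bar> < R}" for e R :: real
  have int: "set_integrable lborel (S e R) (\<lambda>y. f y / (y - x))" if "0 < e" "e < R" for e R
    using H that unfolding has_hilbert_transform_def S_def by blast
  have lim: "((\<lambda>(e, R). 1 / pi * (LINT y:S e R|lborel. f y / (y - x))) \<longlongrightarrow> v) (at_right 0 \<times>\<^sub>F at_top)"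
    using H unfolding has_hilbert_transform_def S_def by blast
  have pair: "(f (x + s) - f (x - s)) / s \<le> (if s < x then - c else 0)" if s: "s > 0" for s
  proof -
    \<comment> \<open>By evenness \<open>x - s\<close> may be replaced by
      \<open>\<bar>x - s\<bar>\<close>, which lies between 0 and \<open>x + s\<close>, where
      monotonicity applies even if \<open>s > x\<close>.\<close>
    have "f \<bar>x - s\<bar> = f (x - s)" using even[of "x - s"] by (simp add: abs_if)
    moreover have "f (x + s) \<le> f \<bar>x - s\<bar>"
      by (rule monotone_onD[OF anti]) (use s x in auto)
    moreover have "f (x + s) - f (x - s) \<le> - c * s" if "s < x"
      using slope[OF s that] monotone_onD[OF anti, of "x - s" x] that s x by auto
    ultimately show ?thesis
      using s by (auto simp: divide_le_eq)
  qed
  have bound: "(LINT y:S e R|lborel. f y / (y - x)) \<le> - (c * (x / 2))"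
    if e: "0 < e" "e < x / 2" and R: "x < R" for e R
  proof -
    define G where "G = (\<lambda>y. indicator (S e R) y * (f y / (y - x)))"
    have G: "integrable lborel G"
      using int[of e R] e R x by (simp add: set_integrable_def G_def)
    have eq: "(LINT y:S e R|lborel. f y / (y - x)) = integral\<^sup>L lborel G"
      by (simp add: set_lebesgue_integral_def G_def)
    have i1: "integrable lborel (\<lambda>s. G (x + 1 * s))" and i2: "integrable lborel (\<lambda>s. G (x + (-1) * s))"
      by (rule lborel_integrable_real_affine[OF G]; simp)+
    \<comment> \<open>Both substitutions run over all real \<open>s\<close>, so each pair
      \<open>x + s\<close>, \<open>x - s\<close> occurs for \<open>s\<close> and for
      \<open>- s\<close>; hence the factor 2.\<close>
    have "2 * integral\<^sup>L lborel G = (LINT s|lborel. G (x + 1 * s)) + (LINT s|lborel. G (x + (-1) * s))"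
      using lborel_integral_real_affine[of 1 G x] lborel_integral_real_affine[of "-1" G x] by simp
    also have "\<dots> = (LINT s|lborel. G (x + 1 * s) + G (x + (-1) * s))"
      by (rule Bochner_Integration.integral_add[symmetric, OF i1 i2])
    \<comment> \<open>The majorant is supported in \<open>x/2 \<le> \<bar>s\<bar> < x\<close>, of
      total length \<open>x\<close>. This set survives the truncation since \<open>e < x/2\<close>
      and \<open>x < R\<close>.\<close>
    also have "\<dots> \<le> (LINT s|lborel. - c * (indicator {x/2..<x} s + indicator {- x<..-x/2} s))"
    proof (rule integral_mono[OF Bochner_Integration.integrable_add[OF i1 i2]])
      show "integrable lborel (\<lambda>s. - c * (indicator {x/2..<x} s + indicator {- x<..-x/2} s))"
        by (intro integrable_mult_right Bochner_Integration.integrable_add integrable_real_indicator)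
          (use x in auto)
      fix s :: real
      have sum: "G (x + 1 * s) + G (x + (-1) * s) =
          (if e < \<bar>s\<bar> \<and> \<bar>s\<bar> < R then (f (x + \<bar>s\<bar>) - f (x - \<bar>s\<bar>)) / \<bar>s\<bar> else 0)"
        by (auto simp: G_def S_def indicator_def abs_if diff_divide_distrib)
      show "G (x + 1 * s) + G (x + (-1) * s) \<le> - c * (indicator {x/2..<x} s + indicator {- x<..-x/2} s)"
      proof -
        have "(if e < \<bar>s\<bar> \<and> \<bar>s\<bar> < R then q else 0)
            \<le> - c * (indicator {x/2..<x} s + indicator {- x<..-x/2} s)"
          if "\<bar>s\<bar> > 0 \<Longrightarrow> q \<le> (if \<bar>s\<bar> < x then - c else 0)" for q
          using that e R x c by (cases "s = 0") (auto simp: indicator_def split: if_splits)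
        then show ?thesis unfolding sum using pair by blast
      qed
    qed
    also have "\<dots> = - c * x"
      using x by (subst integral_mult_right_zero) (subst Bochner_Integration.integral_add; simp)
    finally show ?thesis by (simp add: eq)
  qed
  have "eventually (\<lambda>p. fst p \<in> {0<..<x/2} \<and> snd p > x) (at_right (0::real) \<times>\<^sub>F at_top)"
    unfolding eventually_prod_filter
    using eventually_at_right_real[of 0 "x/2"] eventually_gt_at_top[of x] x
    by (intro exI[of _ "\<lambda>e. e \<in> {0<..<x/2}"] exI[of _ "\<lambda>R. R > x"]) auto
  then have "eventually (\<lambda>p. (case p of (e, R) \<Rightarrow> 1 / pi * (LINT y:S e R|lborel. f y / (y - x)))
      \<le> 1 / pi * - (c * (x / 2))) (at_right 0 \<times>\<^sub>F at_top)"
    by (rule eventually_mono) (auto simp only: split: prod.split intro!: mult_left_mono bound, auto)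
  then have "v \<le> 1 / pi * - (c * (x / 2))"
    by (rule tendsto_upperbound[OF lim]) (simp add: prod_filter_eq_bot)
  then show ?thesis by simp
qed

section \<open>Joint continuity and first contact\<close>

text \<open>On a compact set \<open>ft\<close> is bounded, so \<open>f\<close> is Lipschitz in time
  uniformly in \<open>x\<close>; this combines with continuity in \<open>x\<close> at a fixed time.
  It is needed because \<open>C1_partials\<close> asserts joint continuity of the partial
  derivatives only.\<close>

lemma continuous_on_Times_of_bounded_time_derivative:
  fixes f :: "real \<Rightarrow> real \<Rightarrow> real"
  assumes S: "convex S" "compact S" and K: "compact K"
    and der: "\<And>t x. t \<in> S \<Longrightarrow> x \<in> K \<Longrightarrow> ((\<lambda>s. f s x) has_real_derivative ft t x) (at t within S)"
    and ft: "continuous_on (S \<times> K) (\<lambda>(t, x). ft t x)"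
    and fx: "\<And>t. t \<in> S \<Longrightarrow> continuous_on K (f t)"
  shows "continuous_on (S \<times> K) (\<lambda>(t, x). f t x)"
proof -
  have "bounded ((\<lambda>(t, x). ft t x) ` (S \<times> K))"
    using S K ft by (intro compact_imp_bounded compact_continuous_image compact_Times)
  then obtain M where M: "\<And>t x. t \<in> S \<Longrightarrow> x \<in> K \<Longrightarrow> \<bar>ft t x\<bar> \<le> M"
    unfolding bounded_iff by fastforce
  have lip: "\<bar>f s x - f t x\<bar> \<le> M * \<bar>s - t\<bar>" if "s \<in> S" "t \<in> S" "x \<in> K" for s t x
    using field_differentiable_bound[OF \<open>convex S\<close>, of "\<lambda>s. f s x" "\<lambda>s. ft s x" M s t] der M that by auto
  show ?thesis
    unfolding continuous_on_def
  proof (clarsimp)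
    fix t x assume tx: "t \<in> S" "x \<in> K"
    let ?F = "at (t, x) within S \<times> K"
    have "((\<lambda>p. f t (snd p)) \<longlongrightarrow> f t x) ?F"
      using continuous_on_compose2[OF fx[OF tx(1)] continuous_on_snd[OF continuous_on_id], of "S \<times> K"] tx
      by (auto simp: continuous_on_def)
    moreover have "((\<lambda>p. M * \<bar>fst p - t\<bar>) \<longlongrightarrow> M * \<bar>fst (t, x) - t\<bar>) ?F"
      by (intro tendsto_intros)
    ultimately have "((\<lambda>p. M * \<bar>fst p - t\<bar> + \<bar>f t (snd p) - f t x\<bar>) \<longlongrightarrow> M * \<bar>fst (t, x) - t\<bar> + \<bar>f t x - f t x\<bar>) ?F"
      by (intro tendsto_intros)
    then have "((\<lambda>p. M * \<bar>fst p - t\<bar> + \<bar>f t (snd p) - f t x\<bar>) \<longlongrightarrow> 0) ?F" by simp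
    moreover have "eventually (\<lambda>p. norm (f (fst p) (snd p) - f t x) \<le> M * \<bar>fst p - t\<bar> + \<bar>f t (snd p) - f t x\<bar>) ?F"
      unfolding eventually_at_filter
    proof (rule always_eventually, clarsimp)
      fix s y assume "s \<in> S" "y \<in> K"
      then show "\<bar>f s y - f t x\<bar> \<le> M * \<bar>s - t\<bar> + \<bar>f t y - f t x\<bar>"
        using lip[of s t y] tx by linarith
    qed
    ultimately have "((\<lambda>p. f (fst p) (snd p) - f t x) \<longlongrightarrow> 0) ?F"
      by (rule Lim_null_comparison[rotated])
    then show "((\<lambda>(t, x). f t x) \<longlongrightarrow> f t x) ?F"
      unfolding case_prod_unfold by (simp add: LIM_zero_iff)
  qed
qed

text \<open>The set where \<open>F \<ge> 0\<close> is compact and so contains a point of least time.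
  A positive value at that time would, by the intermediate value theorem in time, force an earlier
  zero.\<close>

lemma first_crossing:
  fixes F :: "real \<Rightarrow> real \<Rightarrow> real"
  assumes K: "compact K" and cont: "continuous_on ({0..T} \<times> K) (\<lambda>(t, x). F t x)"
    and init: "\<And>x. x \<in> K \<Longrightarrow> F 0 x < 0"
    and T: "0 \<le> T" and z: "z \<in> K" "F T z \<ge> 0"
  obtains t x where "0 < t" "t \<le> T" "x \<in> K" "F t x = 0"
    "\<And>y. y \<in> K \<Longrightarrow> F t y \<le> 0" "\<And>s y. 0 \<le> s \<Longrightarrow> s < t \<Longrightarrow> y \<in> K \<Longrightarrow> F s y < 0"
proof -
  define C where "C = ({0..T} \<times> K) \<inter> (\<lambda>(t, x). F t x) -` {0..}"
  have D: "compact ({0..T} \<times> K)" using K by (intro compact_Times) auto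
  have "closed C"
    unfolding C_def by (rule continuous_closed_preimage[OF cont compact_imp_closed[OF D] closed_atLeast])
  then have "compact C"
    using compact_Int_closed[OF D, of C] by (simp add: C_def Int_absorb1)
  moreover have "(T, z) \<in> C" using z T by (simp add: C_def)
  ultimately obtain p where p: "p \<in> C" "\<And>q. q \<in> C \<Longrightarrow> fst p \<le> fst q"
    using continuous_attains_inf[of C fst] continuous_on_fst[OF continuous_on_id] by blast
  obtain t x where tx: "p = (t, x)" by fastforce
  have t: "0 \<le> t" "t \<le> T" "x \<in> K" "F t x \<ge> 0" using p(1) by (auto simp: tx C_def)
  have before: "F s y < 0" if "0 \<le> s" "s < t" "y \<in> K" for s y
    using p(2)[of "(s, y)"] that t by (force simp: C_def tx)
  have le: "F t y \<le> 0" if y: "y \<in> K" for y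
  proof (rule ccontr)
    assume pos: "\<not> F t y \<le> 0"
    have "continuous_on {0..t} ((\<lambda>(t, x). F t x) \<circ> (\<lambda>s. (s, y)))"
      using t y by (intro continuous_on_compose continuous_intros continuous_on_subset[OF cont]) auto
    then have "continuous_on {0..t} (\<lambda>s. F s y)" by (simp add: o_def)
    then obtain s where "0 \<le> s" "s \<le> t" "F s y = 0"
      using IVT'[of "\<lambda>s. F s y" 0 0 t] init[OF y] pos t by auto
    then show False using before[of s y] y pos by (cases "s = t") auto
  qed
  show thesis
  proof
    show "0 < t" using init[of x] t by (cases "t = 0") auto
  qed (use t le before in \<open>auto intro: antisym\<close>)
qed

section \<open>The barrier argument\<close>

text \<open>By concavity the chord of \<open>sqrt\<close> over \<open>[x, 2x]\<close> bounds it from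
  below; its slope is \<open>(sqrt 2 - 1) / sqrt x\<close>, and
  \<open>1/3 < sqrt 2 - 1\<close>.\<close>

lemma sqrt_increment_ge:
  assumes "0 < s" "s < x"
  shows "sqrt x + s / (3 * sqrt x) \<le> sqrt (x + s)"
proof (rule real_le_rsqrt)
  have x: "0 < x" using assms by simp
  have "(sqrt x + s / (3 * sqrt x))\<^sup>2 = x + 2 * s / 3 + s * (s / x) / 9"
    using x by (simp add: power2_sum power_divide power_mult_distrib) (simp add: power2_eq_square)
  moreover have "s * (s / x) \<le> s * 1" using assms x by (intro mult_left_mono) auto
  then have "x + 2 * s / 3 + q / 9 \<le> x + s" if "q = s * (s / x)" for q
    using assms that by linarith
  ultimately show "(sqrt x + s / (3 * sqrt x))\<^sup>2 \<le> x + s" by simp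
qed

text \<open>The threshold \<open>12 * pi\<close> is the product of 3 from the chord of
  \<open>sqrt\<close>, \<open>2 * pi\<close> from the Hilbert transform bound and 2 from the
  derivative of \<open>sqrt\<close>.\<close>

lemma transport_barrier:
  fixes \<theta> :: "real \<Rightarrow> real \<Rightarrow> real"
  assumes I: "is_interval I" "0 \<in> I" "I \<subseteq> {0..}"
    and sol: "C1_transport_solution I \<theta>"
    and even: "\<And>t x. t \<in> I \<Longrightarrow> \<theta> t (- x) = \<theta> t x"
    and anti: "\<And>t. t \<in> I \<Longrightarrow> antimono_on {0<..} (\<theta> t)"
    and T: "T \<in> I" "T > 0" and A: "12 * pi < A"
  shows "\<theta> T x \<le> \<theta> 0 (1/2) + A / T * max (1 - sqrt \<bar>x\<bar>) 0"
proof -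
  define h where "h = \<theta> 0 (1/2)"
  obtain \<theta>t \<theta>x u where
    dt: "\<And>t x. t \<in> I \<Longrightarrow> ((\<lambda>s. \<theta> s x) has_real_derivative \<theta>t t x) (at t within I)"
    and dx: "\<And>t x. t \<in> I \<Longrightarrow> (\<theta> t has_real_derivative \<theta>x t x) (at x)"
    and ct: "continuous_on (I \<times> UNIV) (\<lambda>(t, x). \<theta>t t x)"
    and H: "\<And>t x. t \<in> I \<Longrightarrow> has_hilbert_transform (\<theta> t) (u t x) x"
    and pde: "\<And>t x. t \<in> I \<Longrightarrow> \<theta>t t x + u t x * \<theta>x t x = 0"
    using sol unfolding C1_transport_solution_def C1_partials_def by blast
  have sub: "{0..t} \<subseteq> I" if "t \<in> I" for t
    using mem_is_interval_1_I[OF I(1,2) that] by auto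
  have anti0: "antimono_on {0..} (\<theta> t)" if "t \<in> I" for t
    using antimono_on_atLeast_zero[OF anti[OF that]] DERIV_isCont[OF dx[OF that]] by blast
  \<comment> \<open>At \<open>x = 1/2\<close> both \<open>u\<close> and \<open>\<theta>x\<close> are
    nonpositive, so the equation gives \<open>\<theta>t \<le> 0\<close>, and the mean value theorem
    applies.\<close>
  have half: "\<theta> t (1/2) \<le> h" if t: "t \<in> I" for t
  proof (cases "t = 0")
    case False
    then have t0: "0 < t" using I t by force
    have "((\<lambda>s. \<theta> s (1/2)) has_derivative (*) (\<theta>t s (1/2))) (at s within {0..t})"
      if "s \<in> {0..t}" for s
      using dt sub[OF t] that unfolding has_field_derivative_def[symmetric]
      by (meson DERIV_subset subsetD)
    then have "\<exists>s\<in>{0<..<t}. \<theta> t (1/2) - \<theta> 0 (1/2) = \<theta>t s (1/2) * (t - 0)"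
      using mvt_simple[OF t0, of "\<lambda>s. \<theta> s (1/2)" "\<lambda>s. (*) (\<theta>t s (1/2))"] by auto
    then obtain s where s: "s \<in> {0<..<t}" "\<theta> t (1/2) - \<theta> 0 (1/2) = t * \<theta>t s (1/2)"
      by (auto simp: mult.commute)
    then have sI: "s \<in> I" using sub[OF t] by auto
    have "u s (1/2) \<le> - (0 * (1/2) / (2 * pi))"
      by (rule hilbert_transform_le[OF H[OF sI] even[OF sI] anti0[OF sI]])
        (auto intro!: monotone_onD[OF anti0[OF sI]])
    moreover have "\<theta>x s (1/2) \<le> 0"
    proof (rule ccontr)
      assume "\<not> ?thesis"
      then obtain d where d: "d > 0" "\<forall>r>0. r < d \<longrightarrow> \<theta> s (1/2) < \<theta> s (1/2 + r)"
        using DERIV_pos_inc_right[OF dx[OF sI]] by (metis not_le)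
      then show False
        using d(1) d(2)[rule_format, of "d/2"] monotone_onD[OF anti0[OF sI], of "1/2" "1/2 + d/2"]
        by (simp add: not_less[symmetric])
    qed
    ultimately have "0 \<le> u s (1/2) * \<theta>x s (1/2)" by (simp add: mult_nonpos_nonpos)
    then have "\<theta>t s (1/2) \<le> 0" using pde[OF sI, of "1/2"] by linarith
    then show ?thesis using s(2) t0 mult_nonneg_nonpos[of t "\<theta>t s (1/2)"] by (simp add: h_def)
  qed (simp add: h_def)
  have far: "\<theta> t x \<le> h" if t: "t \<in> I" and "1/2 \<le> x" for t x
    using monotone_onD[OF anti0[OF t], of "1/2" x] half[OF t] that by auto
  \<comment> \<open>Multiplying the excess over the barrier by \<open>t\<close> removes the
    singularity at \<open>t = 0\<close>, where \<open>F\<close> is then strictly negative on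
    \<open>[0, 1/2]\<close>.\<close>
  define F where "F t x = t * (\<theta> t x - h) - A * (1 - sqrt x)" for t x
  have A0: "A > 0" using A pi_gt_zero by linarith
  have near: "F T x \<le> 0" if x: "x \<in> {0..1/2}" for x
  proof (rule ccontr)
    assume pos: "\<not> ?thesis"
    have "continuous_on ({0..T} \<times> {0..1/2}) (\<lambda>(t, x). \<theta> t x)"
    proof (rule continuous_on_Times_of_bounded_time_derivative)
      show "continuous_on ({0..T} \<times> {0..1/2}) (\<lambda>(t, x). \<theta>t t x)"
        using sub[OF T(1)] by (intro continuous_on_subset[OF ct]) auto
    qed (use sub[OF T(1)] in \<open>auto intro!: DERIV_subset[OF dt] continuous_at_imp_continuous_on DERIV_isCont[OF dx]\<close>)
    then have cF: "continuous_on ({0..T} \<times> {0..1/2}) (\<lambda>(t, x). F t x)"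
      unfolding F_def case_prod_beta by (intro continuous_intros)
    have F0: "F 0 y < 0" if "y \<in> {0..1/2}" for y
    proof -
      have "sqrt y < 1" using that by simp
      then show ?thesis using A0 by (simp add: F_def)
    qed
    have "0 \<le> F T x" using pos by simp
    from first_crossing[OF compact_Icc cF F0 less_imp_le[OF T(2)] x this]
    obtain t a where t: "0 < t" "t \<le> T" and a: "a \<in> {0..1/2}" "F t a = 0"
      and max: "\<And>y. y \<in> {0..1/2} \<Longrightarrow> F t y \<le> 0"
      and before: "\<And>s y. 0 \<le> s \<Longrightarrow> s < t \<Longrightarrow> y \<in> {0..1/2} \<Longrightarrow> F s y < 0"
      by blast
    have tI: "t \<in> I" using sub[OF T(1)] t by auto
    have "a \<noteq> 1/2"
    proof
      assume "a = 1/2"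
      then have "t * (\<theta> t (1/2) - h) - A * (1 - sqrt (1/2)) = 0" using a(2) by (simp only: F_def)
      moreover have "t * (\<theta> t (1/2) - h) \<le> 0" using half[OF tI] t by (simp add: mult_nonneg_nonpos)
      moreover have "A * (1 - sqrt (1/2)) > 0"
      proof -
        have "sqrt (1/2) < (1::real)" by simp
        then show ?thesis using A0 by simp
      qed
      ultimately show False by linarith
    qed
    moreover have "a \<noteq> 0"
    proof
      assume a0: "a = 0"
      \<comment> \<open>in the variable \<open>s = \<surd>x\<close> the cusp becomes a corner\<close>
      have "(\<theta> t has_real_derivative \<theta>x t 0) (at (0\<^sup>2))" using dx[OF tI, of 0] by simp
      moreover have "((\<lambda>s::real. s\<^sup>2) has_real_derivative 0) (at 0)"
        by (auto intro!: derivative_eq_intros)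
      ultimately have "((\<lambda>s. \<theta> t (s\<^sup>2)) has_real_derivative \<theta>x t 0 * 0) (at 0)"
        by (rule DERIV_chain2)
      then have "((\<lambda>s. t * (\<theta> t (s\<^sup>2) - h) - A * (1 - s)) has_real_derivative A) (at 0)"
        by (auto intro!: derivative_eq_intros)
      then obtain d where d: "d > 0" "\<And>s. 0 < s \<Longrightarrow> s < d \<Longrightarrow>
          t * (\<theta> t (0\<^sup>2) - h) - A * (1 - 0) < t * (\<theta> t ((0 + s)\<^sup>2) - h) - A * (1 - (0 + s))"
        using DERIV_pos_inc_right[OF _ A0] by blast
      define s where "s = min (d/2) (1/2)"
      have s: "0 < s" "s < d" "s \<le> 1/2" using d(1) by (auto simp: s_def)
      have "s\<^sup>2 \<le> 1/2 * 1" unfolding power2_eq_square using s by (intro mult_mono) auto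
      then have "F t (s\<^sup>2) \<le> 0" using s by (intro max) auto
      then show False using d(2)[OF s(1,2)] a(2) s(1) by (simp add: F_def a0)
    qed
    ultimately have a': "0 < a" "a < 1/2" using a(1) by auto
    define r where "r = sqrt a"
    have r: "0 < r" "r * r = a" using a' by (auto simp: r_def)
    have touch: "\<theta> t a - h = A * (1 - r) / t"
      using a(2) t by (simp add: F_def r_def field_simps)
    have "((\<lambda>y. F t y) has_real_derivative t * \<theta>x t a + A * (inverse r / 2)) (at a)"
      unfolding F_def r_def using a' by (auto intro!: derivative_eq_intros dx[OF tI])
    \<comment> \<open>The radius keeps \<open>y\<close> in \<open>[0, 1/2]\<close>, so
      \<open>a\<close> is a local maximum of \<open>F t\<close>: the graph is tangent to the barrier
      there.\<close>
    moreover have "\<forall>y. \<bar>a - y\<bar> < min a (1/2 - a) \<longrightarrow> F t y \<le> F t a"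
      using a(2) by (auto intro!: max)
    ultimately have "t * \<theta>x t a + A * (inverse r / 2) = 0"
      using a' by (intro DERIV_local_max[of "F t" _ a "min a (1/2 - a)"]) auto
    then have slope: "\<theta>x t a = - A / (2 * t * r)"
      using t r by (simp add: field_simps)
    have "u t a \<le> - (A / (3 * t * r) * a / (2 * pi))"
    proof (rule hilbert_transform_le[OF H[OF tI] even[OF tI] anti0[OF tI] a'(1)])
      fix s assume s: "0 < s" "s < a"
      \<comment> \<open>The point \<open>a + s\<close> may exceed 1/2, outside the range controlled
        by \<open>F\<close>; there \<open>\<theta> t \<le> h\<close>, and the barrier is still at
        least \<open>h\<close> because \<open>a + s < 1\<close>.\<close>
      have "\<theta> t (a + s) \<le> h + A * (1 - sqrt (a + s)) / t"
      proof (cases "a + s \<le> 1/2")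
        case True
        then have "t * (\<theta> t (a + s) - h) \<le> A * (1 - sqrt (a + s))"
          using max[of "a + s"] s by (auto simp: F_def)
        then show ?thesis using t by (simp add: field_simps)
      next
        case False
        have "sqrt (a + s) \<le> 1" using s a' by simp
        then have "0 \<le> A * (1 - sqrt (a + s)) / t" using A0 t by simp
        then show ?thesis using far[OF tI, of "a + s"] False by linarith
      qed
      also have "\<dots> \<le> h + A * (1 - (r + s / (3 * r))) / t"
        using sqrt_increment_ge[OF s] A0 t unfolding r_def
        by (intro add_left_mono divide_right_mono mult_left_mono diff_left_mono) auto
      also have "\<dots> = \<theta> t a - A / (3 * t * r) * s"
      proof -
        have "\<theta> t a = h + A * (1 - r) / t" using touch by simp
        show ?thesis unfolding \<open>\<theta> t a = _\<close> using t r(1) by (simp add: field_simps)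
      qed
      finally show "\<theta> t (a + s) \<le> \<theta> t a - A / (3 * t * r) * s" .
    qed (use A0 t r in auto)
    also have "\<dots> = - (A * r / (6 * pi * t))"
      using t r by (simp add: field_simps flip: r(2))
    \<comment> \<open>The factor is \<open>- \<theta>x t a\<close>. The powers of \<open>r\<close>
      cancel, so the resulting rate does not depend on the contact point; this is what the square
      root profile achieves.\<close>
    finally have "u t a * (A / (2 * t * r)) \<le> - (A * r / (6 * pi * t)) * (A / (2 * t * r))"
      using A0 t r by (intro mult_right_mono) auto
    moreover have "\<theta>t t a = u t a * (A / (2 * t * r))"
      using pde[OF tI, of a] slope by simp
    moreover have "- (A * r / (6 * pi * t)) * (A / (2 * t * r)) = - (A / (12 * pi) * A / t\<^sup>2)"
      using t r by (simp add: field_simps power2_eq_square)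
    ultimately have fast: "\<theta>t t a \<le> - (A / (12 * pi) * A / t\<^sup>2)" by linarith
    \<comment> \<open>The time derivative of \<open>F\<close> at the contact is
      \<open>\<theta> t a - h\<close>, at most \<open>A / t\<close>, plus
      \<open>t * \<theta>t t a\<close>, which is below \<open>- A / t\<close> because
      \<open>A > 12 * pi\<close>.\<close>
    have "1 * (A / t) < A / (12 * pi) * (A / t)"
      using A A0 t by (intro mult_strict_right_mono) (auto simp: less_divide_eq)
    moreover have "t * \<theta>t t a \<le> - (A / (12 * pi) * (A / t))"
      using mult_left_mono[OF fast, of t] t by (simp add: power2_eq_square)
    moreover have "\<theta> t a - h \<le> A / t"
      unfolding touch using A0 t r by (intro divide_right_mono) auto
    ultimately have "\<theta> t a - h + t * \<theta>t t a < 0" by linarith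
    moreover have "((\<lambda>s. F s a) has_real_derivative \<theta> t a - h + t * \<theta>t t a) (at t within I)"
      unfolding F_def by (auto intro!: derivative_eq_intros dt[OF tI])
    ultimately obtain d where d: "d > 0" "\<And>s. 0 < s \<Longrightarrow> t - s \<in> I \<Longrightarrow> s < d \<Longrightarrow> F t a < F (t - s) a"
      using has_real_derivative_neg_dec_left by blast
    \<comment> \<open>A negative time derivative makes \<open>F\<close> positive shortly before
      \<open>t\<close>, against minimality of \<open>t\<close>; the cap at \<open>t\<close> keeps
      \<open>t - s\<close> in \<open>I\<close>.\<close>
    define s where "s = min (d/2) t"
    have s: "0 < s" "s < d" "s \<le> t" using d(1) t by (auto simp: s_def)
    then have "t - s \<in> I" using sub[OF tI] t by auto
    then show False using d(2)[of s] before[of "t - s" a] s a by auto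
  qed
  have abs: "\<theta> T x = \<theta> T \<bar>x\<bar>" using even[OF T(1), of x] by (simp add: abs_if)
  show ?thesis
  proof (cases "\<bar>x\<bar> \<le> 1/2")
    case True
    then have "T * (\<theta> T \<bar>x\<bar> - h) \<le> A * (1 - sqrt \<bar>x\<bar>)" using near[of "\<bar>x\<bar>"] by (simp add: F_def)
    then have "\<theta> T \<bar>x\<bar> \<le> h + A / T * (1 - sqrt \<bar>x\<bar>)" using T by (simp add: field_simps)
    also have "\<dots> \<le> h + A / T * max (1 - sqrt \<bar>x\<bar>) 0"
      using A0 T by (intro add_left_mono mult_left_mono) auto
    finally show ?thesis by (simp add: abs h_def)
  next
    case False
    have "0 \<le> A / T * max (1 - sqrt \<bar>x\<bar>) 0" using A0 T by simp
    then show ?thesis using far[OF T(1), of "\<bar>x\<bar>"] False by (simp add: abs h_def)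
  qed
qed

theorem lemma6p3:
  shows "\<exists>A::real. A > 0 \<and>
    (\<forall>(I :: real set) (\<theta> :: real \<Rightarrow> real \<Rightarrow> real).
       is_interval I \<and> 0 \<in> I \<and> I \<subseteq> {0..} \<and>
       C1_transport_solution I \<theta> \<and>
       (\<forall>t\<in>I. \<forall>x. \<theta> t (- x) = \<theta> t x) \<and>
       (\<forall>t\<in>I. antimono_on {0<..} (\<theta> t)) \<longrightarrow>
       (let h = \<theta> 0 (1/2) in
          \<forall>t\<in>I. t > 0 \<longrightarrow>
            (\<forall>x. \<theta> t x \<le> h + A / t * max (1 - \<bar>x\<bar> powr (1/2)) 0)))"
proof (intro exI[of _ "12 * pi + 1"] conjI)
  show "0 < 12 * pi + 1" using pi_gt_zero by linarith
  show "\<forall>I \<theta>. is_interval I \<and> 0 \<in> I \<and> I \<subseteq> {0..} \<and>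
       C1_transport_solution I \<theta> \<and>
       (\<forall>t\<in>I. \<forall>x. \<theta> t (- x) = \<theta> t x) \<and>
       (\<forall>t\<in>I. antimono_on {0<..} (\<theta> t)) \<longrightarrow>
       (let h = \<theta> 0 (1/2) in
          \<forall>t\<in>I. t > 0 \<longrightarrow>
            (\<forall>x. \<theta> t x \<le> h + (12 * pi + 1) / t * max (1 - \<bar>x\<bar> powr (1/2)) 0))"
    unfolding Let_def powr_half_sqrt[OF abs_ge_zero]
    by (intro allI impI ballI transport_barrier) (auto simp only: less_add_one)
qed

end
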